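(* Let $0<\delta<\tfrac12$, let $k=\left\lfloor \frac{2}{1-2\delta}\right\rfloor$ and \[ p=-\frac{1}{2k}+\sqrt{\frac{1}{4k^2}+\frac{1-2\delta}{k}}. \] Then no deterministic online algorithm for the Online Simple Knapsack problem with item size estimates and additive estimate accuracy $\delta$ has competitive ratio smaller than $\frac1p$; that is, every such algorithm has competitive ratio at least $\frac1p$.
   Context: Online Simple Knapsack with Item Size Estimates (additive accuracy $\delta\ge 0$): an instance consists of actual item sizes $x_1,\dots,x_n\in[0,1]$ together with estimated sizes $x_1',\dots,x_n'$ satisfying $x_i'-\delta\le x_i\le x_i'+\delta$ for all $i$. A deterministic online algorithm knows $\delta$ and the whole list of estimates $x_1',\dots,x_n'$ from the start. The actual sizes are then revealed one at a time in order. When $x_i$ is revealed, the algorithm must irrevocably either pack it into an initially empty knapsack of capacity $1$ (allowed only if the total size already packed plus $x_i$ is at most $1$) or reject it. The gain of an algorithm is the total size of the packed items. The optimal gain $\mathrm{OPT}$ of an instance is the maximum total size of a subset of the actual items with total size at most $1$. The competitive ratio of an algorithm $A$ is $\sup \mathrm{OPT}/\mathrm{gain}_A$, the supremum over all instances with accuracy $\delta$ (with any number of items and any estimates). *)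

theory Defs
  imports Complex_Main "HOL-Library.Extended_Nonnegative_Real"
begin

text \<open>An instance of accuracy \<open>\<delta>\<close> is a list \<open>es\<close> of estimates together with a list \<open>xs\<close> of
  actual sizes. Only the actual sizes are confined to the unit interval.\<close>

definition is_instance :: "real \<Rightarrow> real list \<Rightarrow> real list \<Rightarrow> bool" where
  "is_instance \<delta> es xs \<longleftrightarrow>
     length es = length xs \<and>
     (\<forall>i<length xs. 0 \<le> xs ! i \<and> xs ! i \<le> 1 \<and> es ! i - \<delta> \<le> xs ! i \<and> xs ! i \<le> es ! i + \<delta>)"

text \<open>A deterministic online algorithm maps all the estimates and the actual sizes revealed so
  far, the current item being the last one, to the decision whether to pack the current item. Its
  own earlier decisions are functions of these data, so they are not passed as an argument.\<close>

type_synonym strategy = "real list \<Rightarrow> real list \<Rightarrow> bool"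

definition packed :: "strategy \<Rightarrow> real list \<Rightarrow> real list \<Rightarrow> nat set" where
  "packed A es xs = {i. i < length xs \<and> A es (take (Suc i) xs)}"

definition gain :: "strategy \<Rightarrow> real list \<Rightarrow> real list \<Rightarrow> real" where
  "gain A es xs = (\<Sum>i\<in>packed A es xs. xs ! i)"

definition online_algorithm :: "real \<Rightarrow> strategy \<Rightarrow> bool" where
  "online_algorithm \<delta> A \<longleftrightarrow>
     (\<forall>es xs. is_instance \<delta> es xs \<longrightarrow>
        (\<forall>i\<in>packed A es xs. (\<Sum>j\<in>{j\<in>packed A es xs. j < i}. xs ! j) + xs ! i \<le> 1))"

definition opt_gain :: "real list \<Rightarrow> real" where
  "opt_gain xs =
     Max {(\<Sum>i\<in>I. xs ! i) | I. I \<subseteq> {..<length xs} \<and> (\<Sum>i\<in>I. xs ! i) \<le> 1}"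

text \<open>In \<^typ>\<open>ennreal\<close>, a positive number divided by \<open>0\<close> is \<open>\<infinity>\<close>, so an instance on which the
  algorithm gains nothing although the optimum is positive forces an infinite ratio, whereas
  \<open>0 / 0 = 0\<close>, so instances whose optimum is \<open>0\<close> do not affect the supremum.\<close>

definition competitive_ratio :: "real \<Rightarrow> strategy \<Rightarrow> ennreal" where
  "competitive_ratio \<delta> A =
     (SUP (es, xs)\<in>{(es, xs). is_instance \<delta> es xs}. ennreal (opt_gain xs) / ennreal (gain A es xs))"

end

theory Submission
  imports Defs "HOL-Library.Sublist"
begin

text \<open>The parameter \<open>p\<close> solves \<open>k p\<^sup>2 + p = 1 - 2 \<delta>\<close>, and \<open>k p \<le> 1\<close>. The adversary announces
  many items of estimate \<open>0\<close>, then \<open>k\<close> items of estimate \<open>1/2\<close>, then one item of estimate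
  \<open>1 - p - \<delta>\<close>, whose size can be anything in \<open>[k p\<^sup>2, 1 - p]\<close>. It reveals tiny items of total
  size just below \<open>p\<close>, but replaces them by \<open>0\<close> as soon as one is packed. It continues with items of
  size \<open>p\<close> (marginally more if no tiny item was packed). As soon as one of these is packed, all
  the remaining items have size \<open>1 - p\<close> and just fail to fit, while such an item together with
  either an item of size \<open>p\<close> or all the tiny items almost fills the knapsack. If none is packed,
  the last item has size \<open>k p\<^sup>2\<close>, whereas the optimum is about \<open>k p\<close>.\<close>

section \<open>Instances and gains of revealed prefixes\<close>

lemma is_instance_iff_list_all2:
  "is_instance \<delta> es xs \<longleftrightarrow>
     list_all2 (\<lambda>e x. 0 \<le> x \<and> x \<le> 1 \<and> e - \<delta> \<le> x \<and> x \<le> e + \<delta>) es xs"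
  unfolding is_instance_def list_all2_conv_all_nth by auto

lemma list_all2_replicate1:
  "list_all2 P (replicate n e) xs \<longleftrightarrow> length xs = n \<and> (\<forall>x\<in>set xs. P e x)"
  by (auto simp: list_all2_conv_all_nth all_set_conv_all_nth)

lemma packed_snoc:
  "packed A es (xs @ [x]) = packed A es xs \<union> (if A es (xs @ [x]) then {length xs} else {})"
  by (auto simp: packed_def less_Suc_eq)

lemma gain_Nil [simp]: "gain A es [] = 0"
  by (simp add: gain_def packed_def)

lemma gain_snoc:
  "gain A es (xs @ [x]) = gain A es xs + (if A es (xs @ [x]) then x else 0)"
proof -
  have fin: "finite (packed A es xs)" and notin: "length xs \<notin> packed A es xs"
    by (auto simp: packed_def)
  have "(\<Sum>i\<in>packed A es xs. (xs @ [x]) ! i) = gain A es xs"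
    unfolding gain_def by (rule sum.cong) (auto simp: packed_def nth_append)
  then show ?thesis
    using fin notin by (simp add: gain_def[of A es "xs @ [x]"] packed_snoc)
qed

text \<open>Feasibility is demanded on complete instances, hence the completion \<open>ys\<close>.
  At a packed last item the demand is exactly the bound on the prefix gain; a rejected last item is
  moved into the completion.\<close>

lemma gain_prefix_le_1:
  assumes "online_algorithm \<delta> A" "is_instance \<delta> es (xs @ ys)"
  shows "gain A es xs \<le> 1"
  using assms(2)
proof (induction xs arbitrary: ys rule: rev_induct)
  case (snoc x xs)
  show ?case
  proof (cases "A es (xs @ [x])")
    case True
    let ?zs = "xs @ x # ys"
    have "length xs \<in> packed A es ?zs"
      using True by (simp add: packed_def)
    then have "(\<Sum>j\<in>{j\<in>packed A es ?zs. j < length xs}. ?zs ! j) + ?zs ! length xs \<le> 1"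
      using assms(1) snoc.prems unfolding online_algorithm_def append_assoc append_Cons append_Nil
      by blast
    moreover have "{j\<in>packed A es ?zs. j < length xs} = packed A es xs"
      by (auto simp: packed_def)
    moreover have "(\<Sum>j\<in>packed A es xs. ?zs ! j) = gain A es xs"
      unfolding gain_def by (rule sum.cong) (auto simp: packed_def nth_append)
    ultimately show ?thesis
      using True by (simp add: gain_snoc)
  next
    case False
    then show ?thesis
      using snoc.IH[of "x # ys"] snoc.prems by (simp add: gain_snoc)
  qed
qed simp

lemma gain_append_zeros: "gain A es (xs @ replicate n 0) = gain A es xs"
proof (induction n)
  case (Suc n)
  then show ?case
    using gain_snoc[of A es "xs @ replicate n 0" 0]
    by (simp add: replicate_append_same)
qed simp

text \<open>A first packed item of \<open>ys\<close> would lift the gain of a prefix above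
  1.\<close>

lemma gain_append_overflow:
  assumes "online_algorithm \<delta> A" "is_instance \<delta> es (xs @ ys)"
    and "\<And>y. y \<in> set ys \<Longrightarrow> gain A es xs + y > 1"
  shows "gain A es (xs @ ys) = gain A es xs"
proof -
  have "gain A es (xs @ us) = gain A es xs" if "ys = us @ vs" for us vs
    using that
  proof (induction us arbitrary: vs rule: rev_induct)
    case (snoc u us)
    have "gain A es (xs @ us) = gain A es xs"
      using snoc by simp
    moreover have "gain A es (xs @ us @ [u]) \<le> 1"
      using gain_prefix_le_1[OF assms(1), of es "xs @ us @ [u]" vs] assms(2) snoc.prems by simp
    moreover have "gain A es xs + u > 1"
      using assms(3) snoc.prems by simp
    ultimately show ?case
      using gain_snoc[of A es "xs @ us" u] by (auto split: if_splits)
  qed simp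
  then show ?thesis by simp
qed

text \<open>The second case stops right after the first packed copy, so that the adversary can still
  choose what follows.\<close>

lemma gain_append_replicate_cases:
  obtains (reject) "gain A es (xs @ replicate n v) = gain A es xs"
  | (accept) i where "i < n" "gain A es (xs @ replicate (Suc i) v) = gain A es xs + v"
proof (induction n arbitrary: thesis)
  case (Suc n)
  have eq: "gain A es (xs @ replicate (Suc n) v) = gain A es (xs @ replicate n v)
      + (if A es (xs @ replicate (Suc n) v) then v else 0)"
    using gain_snoc[of A es "xs @ replicate n v" v] by (simp add: replicate_append_same)
  show ?case
  proof (rule Suc.IH)
    assume *: "gain A es (xs @ replicate n v) = gain A es xs"
    show thesis
    proof (cases "A es (xs @ replicate (Suc n) v)")
      case True
      then show thesis using eq * Suc.prems(2)[of n] by simp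
    next
      case False
      then show thesis using eq * Suc.prems(1) by simp
    qed
  qed (use Suc.prems(2) less_SucI in blast)
qed simp

text \<open>The adaptive adversary, unrolled into one fixed instance per position of the first
  packed \<open>s\<close>. After it no \<open>b\<close> fits. The \<open>k - i\<close> copies of
  \<open>b\<close> bring the phase to \<open>k + 1\<close> items; if every \<open>s\<close> is
  rejected, the last of these is still open.\<close>

lemma threshold_phase_cases:
  assumes "online_algorithm \<delta> A"
    and "\<And>i. i < k \<Longrightarrow> is_instance \<delta> es (xs @ replicate (Suc i) s @ replicate (k - i) b)"
    and "gain A es xs + s + b > 1"
  obtains (reject) "gain A es (xs @ replicate k s) = gain A es xs"
  | (accept) i where "i < k"
      "gain A es (xs @ replicate (Suc i) s @ replicate (k - i) b) = gain A es xs + s"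
proof (rule gain_append_replicate_cases[of A es xs k s])
  fix i assume i: "i < k" and g: "gain A es (xs @ replicate (Suc i) s) = gain A es xs + s"
  have "gain A es ((xs @ replicate (Suc i) s) @ replicate (k - i) b) = gain A es xs + s"
    using gain_append_overflow[OF assms(1), of es "xs @ replicate (Suc i) s" "replicate (k - i) b"]
      assms(2)[OF i] assms(3) g by simp
  then show thesis using accept[OF i] by simp
qed (rule reject)

section \<open>Lower bounds for the optimum and the ratio\<close>

lemma sum_list_nths_eq_sum:
  "sum_list (nths xs N) = (\<Sum>i\<in>{i\<in>N. i < length xs}. xs ! i)" for xs :: "real list"
proof (induction xs rule: rev_induct)
  case (snoc x xs)
  have "{i \<in> N. i < length (xs @ [x])} =
      {i \<in> N. i < length xs} \<union> (if length xs \<in> N then {length xs} else {})"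
    by (auto simp: less_Suc_eq)
  moreover have "(\<Sum>i\<in>{i \<in> N. i < length xs}. (xs @ [x]) ! i) = (\<Sum>i\<in>{i \<in> N. i < length xs}. xs ! i)"
    by (rule sum.cong) (auto simp: nth_append)
  ultimately show ?case
    using snoc by (simp add: nths_append)
qed simp

text \<open>Packings given as subsequences can be checked by list concatenation; \<open>nths\<close>
  recovers the index set.\<close>

lemma opt_gain_ge_subseq:
  assumes "subseq ys xs" "sum_list ys \<le> 1"
  shows "sum_list ys \<le> opt_gain xs"
proof -
  obtain N where "ys = nths xs N"
    using assms(1) by (auto simp: subseq_conv_nths)
  then have eq: "sum_list ys = (\<Sum>i\<in>{i\<in>N. i < length xs}. xs ! i)"
    by (simp add: sum_list_nths_eq_sum)
  let ?S = "{(\<Sum>i\<in>I. xs ! i) | I. I \<subseteq> {..<length xs} \<and> (\<Sum>i\<in>I. xs ! i) \<le> 1}"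
  have "finite ?S"
    by (rule finite_subset[of _ "(\<lambda>I. \<Sum>i\<in>I. xs ! i) ` Pow {..<length xs}"]) auto
  moreover have "sum_list ys \<in> ?S"
    using assms(2) unfolding eq by (intro CollectI exI[of _ "{i\<in>N. i < length xs}"]) auto
  ultimately show ?thesis
    unfolding opt_gain_def by (rule Max_ge)
qed

text \<open>The product form also covers gain 0, where the positive optimum makes the quotient
  infinite.\<close>

lemma competitive_ratio_geI:
  assumes "is_instance \<delta> es xs" "0 < opt_gain xs" "0 \<le> r" "r * gain A es xs \<le> opt_gain xs"
  shows "ennreal r \<le> competitive_ratio \<delta> A"
proof -
  have "ennreal r \<le> ennreal (opt_gain xs) / ennreal (gain A es xs)"
  proof (cases "gain A es xs > 0")
    case True
    then have "r \<le> opt_gain xs / gain A es xs"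
      using assms(4) by (simp add: field_simps)
    then show ?thesis
      using True assms(2) by (simp add: divide_ennreal ennreal_leI)
  next
    case False
    then show ?thesis
      using assms(2) by (simp add: ennreal_neg ennreal_divide_zero)
  qed
  also have "\<dots> \<le> competitive_ratio \<delta> A"
    unfolding competitive_ratio_def using assms(1) by (intro SUP_upper2[of "(es, xs)"]) auto
  finally show ?thesis .
qed

section \<open>The adversary\<close>

text \<open>As \<eta> tends to 0, the last two hypotheses both become \<open>r * p \<le> 1\<close>:
  one compares gain \<open>p\<close> with optimum 1, the other gain \<open>k * p\<^sup>2\<close>
  with optimum \<open>k * p\<close>. The slack makes overflows strict.\<close>

lemma competitive_ratio_ge_up_to_slack:
  fixes \<delta> p \<eta> r :: real and k :: nat
  assumes A: "online_algorithm \<delta> A"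
    and \<delta>: "0 < \<delta>" and p: "0 < p" and k: "0 < k"
    and quad: "k * p\<^sup>2 + p = 1 - 2 * \<delta>" and kp: "k * p \<le> 1" and half: "1 - 2 * \<delta> \<le> 2 * p"
    and \<eta>: "0 < \<eta>" "k * \<eta> < p" "p + \<eta> \<le> 1 / 2"
    and r: "0 \<le> r" "r * (p + \<eta>) \<le> 1 - k * \<eta>" "r * (k * p\<^sup>2 + \<eta>) \<le> k * p - \<eta>"
  shows "ennreal r \<le> competitive_ratio \<delta> A"
proof -
  \<comment> \<open>Chosen so that \<open>T + (k - 1) * (p + \<eta>) = k * p - \<eta>\<close> and
    \<open>T + (1 - p) = 1 - k * \<eta>\<close>, both at most 1.\<close>
  define T where "T = p - k * \<eta>"
  have T: "0 < T" using \<eta> by (simp add: T_def)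
  \<comment> \<open>Each of the \<open>N\<close> pieces is to be admissible for estimate 0 and to
    add at most \<eta> to the gain.\<close>
  obtain N :: nat where N: "T / min \<delta> \<eta> < N"
    using reals_Archimedean2 by blast
  have "0 < T / min \<delta> \<eta>" using T \<delta> \<eta> by simp
  then have N0: "0 < N" using N by (cases N) auto
  define t where "t = T / N"
  have Nt: "N * t = T" using N0 by (simp add: t_def)
  have "T < N * min \<delta> \<eta>" using N \<delta> \<eta> by (simp add: field_simps)
  then have "t < min \<delta> \<eta>" using N0 by (simp add: t_def divide_less_eq mult.commute del: min_less_iff_conj)
  then have t: "0 < t" "t \<le> \<delta>" "t \<le> \<eta>" using T N0 by (auto simp: t_def)
  \<comment> \<open>By \<open>half\<close>, estimate 1/2 admits all sizes between \<open>p\<close>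
    and \<open>1 - p\<close>. By \<open>quad\<close>, the least size for the last estimate,
    \<open>1 - p - 2 * \<delta>\<close>, equals \<open>k * p\<^sup>2\<close>.\<close>
  define es where "es = replicate N 0 @ replicate k (1 / 2) @ [1 - p - \<delta>]"
  have inst: "is_instance \<delta> es (us @ vs @ [w])"
    if "length us = N" "length vs = k" "\<And>x. x \<in> set us \<Longrightarrow> 0 \<le> x \<and> x \<le> \<delta>"
      "\<And>x. x \<in> set vs \<Longrightarrow> p \<le> x \<and> x \<le> 1 - p" "k * p\<^sup>2 \<le> w" "w \<le> 1 - p" for us vs w
  proof -
    have kp2: "0 \<le> k * p\<^sup>2" by simp
    have "x \<le> 1" if "x \<in> set us" for x
      using \<open>x \<in> set us \<Longrightarrow> 0 \<le> x \<and> x \<le> \<delta>\<close> that quad p kp2 by linarith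
    moreover have "x \<le> 1 \<and> x \<le> 1 / 2 + \<delta> \<and> 0 \<le> x \<and> 1 / 2 - \<delta> \<le> x" if "x \<in> set vs" for x
      using \<open>x \<in> set vs \<Longrightarrow> p \<le> x \<and> x \<le> 1 - p\<close> that half p by auto
    moreover have "0 \<le> w" "w \<le> 1" "1 - p - \<delta> - \<delta> \<le> w" "w \<le> 1 - p - \<delta> + \<delta>"
      using that(5,6) kp2 quad p by linarith+
    ultimately show ?thesis
      unfolding is_instance_iff_list_all2 es_def
      using that(1-3) \<delta> by (intro list_all2_appendI) (force simp: list_all2_replicate1)+
  qed
  have p_le: "p \<le> 1 - p" "p + \<eta> \<le> 1 - p" using \<eta> by auto
  have wk: "k * p\<^sup>2 \<le> 1 - p" using quad \<delta> by simp
  have accept: "is_instance \<delta> es (us @ replicate (Suc i) s @ replicate (k - i) (1 - p))"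
    if "i < k" "length us = N" "\<And>x. x \<in> set us \<Longrightarrow> 0 \<le> x \<and> x \<le> \<delta>" "p \<le> s" "s \<le> 1 - p" for i us s
  proof -
    \<comment> \<open>The last copy of \<open>1 - p\<close> falls on the final estimate, the others
      on estimates 1/2.\<close>
    have "replicate (k - i) (1 - p) = replicate (k - Suc i) (1 - p) @ [1 - p]"
      using that(1) by (metis Suc_diff_Suc replicate_Suc replicate_append_same)
    then show ?thesis
      using inst[of us "replicate (Suc i) s @ replicate (k - Suc i) (1 - p)" "1 - p"] that wk p_le(1)
      by (simp split: if_splits) force
  qed
  have reject: "is_instance \<delta> es (us @ replicate k s @ [k * p\<^sup>2])"
    if "length us = N" "\<And>x. x \<in> set us \<Longrightarrow> 0 \<le> x \<and> x \<le> \<delta>" "p \<le> s" "s \<le> 1 - p" for us s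
    using inst[of us "replicate k s" "k * p\<^sup>2"] that wk by auto
  have last: "gain A es (ys @ [k * p\<^sup>2]) \<le> gain A es ys + k * p\<^sup>2" for ys
    by (simp add: gain_snoc)
  have pos: "0 < 1 - k * \<eta>" "0 < k * p - \<eta>"
  proof -
    have "\<eta> \<le> k * \<eta>" "p \<le> k * p" using k \<eta> p by auto
    then show "0 < 1 - k * \<eta>" "0 < k * p - \<eta>" using \<eta> by linarith+
  qed
  have concl: ?thesis
    if "is_instance \<delta> es xs" "subseq ys xs" "sum_list ys \<le> 1" "0 < l" "l \<le> sum_list ys"
      "gain A es xs \<le> g" "r * g \<le> l" for xs ys l g
  proof (rule competitive_ratio_geI[OF that(1)])
    have l: "l \<le> opt_gain xs" using opt_gain_ge_subseq[OF that(2,3)] that(5) by simp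
    then show "0 < opt_gain xs" using that(4) by simp
    show "r * gain A es xs \<le> opt_gain xs"
      using mult_left_mono[OF that(6) r(1)] that(7) l by linarith
  qed (rule r(1))
  \<comment> \<open>Both outcomes of the tiny-item phase continue alike after the prefix
    \<open>us\<close>. The competing packing is \<open>ys\<close> if some \<open>s\<close> is packed
    and \<open>zs\<close> if none is.\<close>
  have phase: ?thesis
    if us: "length us = N" "\<And>x. x \<in> set us \<Longrightarrow> 0 \<le> x \<and> x \<le> \<delta>"
      and s: "p \<le> s" "s \<le> 1 - p"
      and g: "p < gain A es us + s" "gain A es us + s \<le> p + \<eta>"
      and ys: "\<And>i. i < k \<Longrightarrow> subseq ys (us @ replicate (Suc i) s @ replicate (k - i) (1 - p))"
        "1 - k * \<eta> \<le> sum_list ys" "sum_list ys \<le> 1"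
      and zs: "subseq zs (us @ replicate k s)" "k * p - \<eta> \<le> sum_list zs" "sum_list zs \<le> 1"
    for us s ys zs
  proof -
    have over: "gain A es us + s + (1 - p) > 1" using g by simp
    show ?thesis
    proof (rule threshold_phase_cases[OF A accept[OF _ us s] over])
      assume rej: "gain A es (us @ replicate k s) = gain A es us"
      show ?thesis
      proof (rule concl[OF reject[OF us s] _ zs(3) pos(2) zs(2) _ r(3)])
        show "subseq zs (us @ replicate k s @ [k * p\<^sup>2])"
          using subseq_rev_drop_many[OF zs(1), of "[k * p\<^sup>2]"] by simp
        \<comment> \<open>Since \<open>s\<close> is at least \<open>p\<close>, the gain on
          \<open>us\<close> is at most \<eta>.\<close>
        show "gain A es (us @ replicate k s @ [k * p\<^sup>2]) \<le> k * p\<^sup>2 + \<eta>"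
          using last[of "us @ replicate k s"] rej g(2) s(1) by simp
      qed
    next
      fix i assume i: "i < k"
        and acc: "gain A es (us @ replicate (Suc i) s @ replicate (k - i) (1 - p)) = gain A es us + s"
      show ?thesis
        by (rule concl[OF accept[OF i us s] ys(1)[OF i] ys(3) pos(1) ys(2) _ r(2)])
          (assumption, rule ord_eq_le_trans[OF acc g(2)])
    qed
  qed
  have single: "subseq [b] (replicate (Suc i) s @ replicate (k - i) b)"
    if "i < k" for i and b s :: real
    using that by (simp add: subseq_singleton_left)
  show ?thesis
  proof (rule gain_append_replicate_cases[of A es "[]" N t])
    assume rej: "gain A es ([] @ replicate N t) = gain A es []"
    \<comment> \<open>With gain 0, an item of size exactly \<open>p\<close> would leave room for
      \<open>1 - p\<close>; hence \<open>p + \<eta>\<close>. As \<open>k\<close> such items may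
      exceed the capacity, the tiny items replace one of them.\<close>
    let ?ys = "replicate N t @ [1 - p]" and ?zs = "replicate N t @ replicate (k - 1) (p + \<eta>)"
    show ?thesis
    proof (rule phase[of "replicate N t" "p + \<eta>" ?ys ?zs])
      show "subseq ?ys (replicate N t @ replicate (Suc i) (p + \<eta>) @ replicate (k - i) (1 - p))"
        if "i < k" for i
        using list_emb_append_mono[OF subseq_order.order_refl single[OF that]] by blast
      have "replicate k (p + \<eta>) = replicate (k - 1) (p + \<eta>) @ [p + \<eta>]"
        using k by (metis Suc_diff_1 replicate_Suc replicate_append_same)
      then show "subseq ?zs (replicate N t @ replicate k (p + \<eta>))"
        by (metis append.assoc subseq_rev_drop_many subseq_order.order_refl)
      have "sum_list ?zs = k * p - \<eta>"
        using k Nt by (simp add: sum_list_replicate T_def of_nat_diff algebra_simps)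
      then show "k * p - \<eta> \<le> sum_list ?zs" "sum_list ?zs \<le> 1"
        using kp \<eta> by auto
    qed (use t rej p_le \<eta> in \<open>auto simp: sum_list_replicate Nt T_def\<close>)
  next
    fix j assume j: "j < N" and acc: "gain A es ([] @ replicate (Suc j) t) = gain A es [] + t"
    \<comment> \<open>The packed \<open>t\<close> already makes \<open>t + p\<close> exceed
      \<open>p\<close>, so size exactly \<open>p\<close> suffices, and \<open>p\<close> with
      \<open>1 - p\<close> fills the knapsack.\<close>
    let ?us = "replicate (Suc j) t @ replicate (N - Suc j) 0"
    have g: "gain A es ?us = t"
      using acc gain_append_zeros[of A es "replicate (Suc j) t"] by simp
    show ?thesis
    proof (rule phase[of ?us p "[p, 1 - p]" "replicate k p"])
      show "subseq [p, 1 - p] (?us @ replicate (Suc i) p @ replicate (k - i) (1 - p))"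
        if "i < k" for i
      proof -
        have "subseq ([p] @ [1 - p]) (replicate (Suc i) p @ replicate (k - i) (1 - p))"
          using that by (intro list_emb_append_mono) (auto simp: subseq_singleton_left)
        then show ?thesis by (simp only: append_Cons append_Nil list_emb_append2)
      qed
    qed (use j t g p_le \<eta> \<delta> kp in \<open>auto simp: sum_list_replicate intro: list_emb_append2\<close>)
  qed
qed

section \<open>Properties of \<open>p\<close> and vanishing slack\<close>

theorem theorem4:
  fixes \<delta> p :: real and k :: int and A :: strategy
  assumes "0 < \<delta>" and "\<delta> < 1 / 2"
    and "k = \<lfloor>2 / (1 - 2 * \<delta>)\<rfloor>"
    and "p = - (1 / (2 * real_of_int k))
              + sqrt (1 / (4 * (real_of_int k)\<^sup>2) + (1 - 2 * \<delta>) / real_of_int k)"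
    and "online_algorithm \<delta> A"
  shows "competitive_ratio \<delta> A \<ge> ennreal (1 / p)"
proof -
  define c where "c = 1 - 2 * \<delta>"
  have c: "0 < c" "c < 1" using assms(1,2) by (auto simp: c_def)
  define n where "n = nat k"
  have "2 < 2 / c" using c by (simp add: field_simps)
  then have "2 \<le> k" unfolding assms(3) c_def[symmetric] by linarith
  then have n: "real_of_int k = real n" "2 \<le> n" by (auto simp: n_def)
  have "real n \<le> 2 / c" unfolding n(1)[symmetric] assms(3) c_def[symmetric] by simp
  then have nc: "n * c \<le> 2" using c by (simp add: field_simps)
  define q where "q = sqrt (1 / (4 * (real n)\<^sup>2) + c / n)"
  have p_eq: "p = q - 1 / (2 * n)" using assms(4) n by (simp add: q_def c_def)
  have q2: "q\<^sup>2 = 1 / (4 * (real n)\<^sup>2) + c / n" using c by (simp add: q_def)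
  have "1 / (2 * n) < q" unfolding q_def
    using c n(2) by (intro real_less_rsqrt) (simp add: power_divide power_mult_distrib)
  then have p: "0 < p" by (simp add: p_eq)
  have quad: "n * p\<^sup>2 + p = c"
  proof -
    have "n * p\<^sup>2 + p = n * q\<^sup>2 - 1 / (4 * n)"
      using n(2) by (simp add: p_eq power2_eq_square field_simps)
    also have "\<dots> = c" using n(2) unfolding q2 by (simp add: power2_eq_square field_simps)
    finally show ?thesis .
  qed
  \<comment> \<open>The quadratic is increasing and takes the value \<open>c\<close> at
    \<open>p\<close>, so comparing values at \<open>c / 2\<close> and \<open>1 / n\<close> bounds
    \<open>p\<close> from below and above. Both comparisons rest on \<open>n * c \<le> 2\<close>,
    which the floor in \<open>k\<close> guarantees.\<close>
  have mono: "x \<le> y" if "n * x\<^sup>2 + x \<le> n * y\<^sup>2 + y" "0 \<le> x" "0 \<le> y" for x y :: real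
  proof (rule ccontr)
    assume "\<not> x \<le> y"
    then have "y < x" by simp
    moreover have "n * y\<^sup>2 \<le> n * x\<^sup>2"
      using \<open>y < x\<close> that by (intro mult_left_mono power_mono) auto
    ultimately show False using that(1) by linarith
  qed
  have half: "c \<le> 2 * p"
  proof -
    have "n * (c / 2)\<^sup>2 + c / 2 \<le> c"
      using mult_right_mono[OF nc, of c] c by (simp add: power2_eq_square field_simps)
    then show ?thesis using mono[of "c / 2" p] quad c p by simp
  qed
  have np: "n * p \<le> 1"
  proof -
    have "n * p\<^sup>2 + p \<le> n * (1 / n)\<^sup>2 + 1 / n"
      using nc n(2) unfolding quad by (simp add: power2_eq_square field_simps)
    then show ?thesis using mono[of p "1 / n"] p n(2) by (simp add: field_simps)
  qed
  have p_half: "p < 1 / 2"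
  proof (rule ccontr)
    assume "\<not> p < 1 / 2"
    \<comment> \<open>The left side is 1, which exceeds \<open>c\<close>.\<close>
    then have "2 * (1 / 2)\<^sup>2 + 1 / 2 \<le> n * p\<^sup>2 + p"
      using n(2) by (intro add_mono mult_mono power_mono) auto
    then show False using quad c by (simp add: power2_eq_square)
  qed
  show ?thesis
  proof (rule dense_le)
    fix y assume y: "y < ennreal (1 / p)"
    then obtain r where r: "y = ennreal r" "0 \<le> r" "r < 1 / p"
      by (cases y) (auto simp: ennreal_less_iff)
    define d where "d = 1 - r * p"
    have d: "0 < d" using r p by (simp add: d_def field_simps)
    \<comment> \<open>The first two entries are the conditions on \<open>r\<close> solved for
      \<eta>, positive because \<open>r\<close> is strictly below \<open>1 / p\<close>. The third is
      halved to give \<open>n * \<eta> < p\<close> strictly.\<close>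
    define \<eta> where "\<eta> = Min {d / (n + r), n * p * d / (1 + r), p / (2 * n), 1 / 2 - p}"
    have "0 < \<eta>" using d n p p_half r by (simp add: \<eta>_def)
    moreover have "\<eta> \<le> d / (n + r)" "\<eta> \<le> n * p * d / (1 + r)" "\<eta> \<le> p / (2 * n)" "\<eta> \<le> 1 / 2 - p"
      unfolding \<eta>_def by (intro Min_le; simp)+
    then have "\<eta> * (n + r) \<le> d" "\<eta> * (1 + r) \<le> n * p * d" "2 * (n * \<eta>) \<le> p" "p + \<eta> \<le> 1 / 2"
      using n r by (auto simp: pos_le_divide_eq algebra_simps)
    ultimately have "ennreal r \<le> competitive_ratio \<delta> A"
      using n p quad np half r
      by (intro competitive_ratio_ge_up_to_slack[OF assms(5,1), of p n \<eta>])
        (auto simp: d_def c_def algebra_simps power2_eq_square)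
    then show "y \<le> competitive_ratio \<delta> A" using r by simp
  qed
qed

end
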